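(* Let $n \in \mathbb{N}$ and let $\mathbf{m} \in \mathbb{N}_{0}^{n \times n}$ be an irreducible matrix which has all row sums and all column sums equal to $2$, and let $m_{ij} =0$ if and only if $m_{ji}=0$ for all $i,j = 1, \ldots, n$. Then there exists a unique (up to its shift and a reflection) $\mathbf{m}$-perfect coloring of the infinite path graph, and this coloring is periodic.
   Context: The infinite path graph has vertex set $V=\mathbb{Z}$ and edge set $E=\{\{i,i+1\}: i\in\mathbb{Z}\}$. A coloring with colors $C=\{1,\dots,n\}$ is a map $\Gamma:\mathbb{Z}\to C$. It is $\mathbf{m}$-perfect if for every $i\in\mathbb{Z}$ and every $c\in C$ the number of $j\in\{i-1,i+1\}$ with $\Gamma(j)=c$ equals $m_{\Gamma(i)c}$. It is periodic if there exists $\ell\in\mathbb{N}$, $\ell\geq 1$, such that $\Gamma(i)=\Gamma(i+\ell)$ for all $i\in\mathbb{Z}$. Uniqueness up to shift and reflection means that any two such colorings $\Gamma,\Gamma'$ satisfy $\Gamma'(i)=\Gamma(\varepsilon i+s)$ for all $i\in\mathbb{Z}$, for some $\varepsilon\in\{1,-1\}$ and $s\in\mathbb{Z}$. *)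

theory Defs
  imports "Jordan_Normal_Form.Matrix" "HOL-Combinatorics.Permutations"
begin

(* A matrix is reducible if a simultaneous permutation of its rows and columns
   (i.e. conjugation by a permutation matrix) brings it to block upper triangular form
   with square diagonal blocks of positive size.  The convention for the 1 x 1 zero
   matrix, which varies in the literature, is left at "irreducible"; it has row sum 0
   and so never matters for matrices with row sums 2. *)
definition reducible_mat :: "nat \<Rightarrow> 'a :: zero mat \<Rightarrow> bool" where
  "reducible_mat n A \<longleftrightarrow>
     (\<exists>p k B C D. p permutes {..<n} \<and> 0 < k \<and> k < n \<and>
        B \<in> carrier_mat k k \<and> C \<in> carrier_mat k (n - k) \<and> D \<in> carrier_mat (n - k) (n - k) \<and>
        mat n n (\<lambda>(i, j). A $$ (p i, p j)) = four_block_mat B C (0\<^sub>m (n - k) k) D)"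

definition irreducible_mat :: "nat \<Rightarrow> 'a :: zero mat \<Rightarrow> bool" where
  "irreducible_mat n A \<longleftrightarrow> A \<in> carrier_mat n n \<and> \<not> reducible_mat n A"

(* Vertices of the infinite path graph are the integers.  Colours are 0, ..., n - 1 instead
   of 1, ..., n, to agree with the indexing of matrices. *)
definition perfect_path_coloring :: "nat \<Rightarrow> nat mat \<Rightarrow> (int \<Rightarrow> nat) \<Rightarrow> bool" where
  "perfect_path_coloring n M \<Gamma> \<longleftrightarrow>
     (\<forall>i. \<Gamma> i < n) \<and>
     (\<forall>i. \<forall>c<n. card {j \<in> {i - 1, i + 1}. \<Gamma> j = c} = M $$ (\<Gamma> i, c))"

definition periodic_coloring :: "(int \<Rightarrow> nat) \<Rightarrow> bool" where
  "periodic_coloring \<Gamma> \<longleftrightarrow> (\<exists>l::nat. l \<ge> 1 \<and> (\<forall>i. \<Gamma> i = \<Gamma> (i + int l)))"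

definition shift_reflection_equiv :: "(int \<Rightarrow> nat) \<Rightarrow> (int \<Rightarrow> nat) \<Rightarrow> bool" where
  "shift_reflection_equiv \<Gamma> \<Gamma>' \<longleftrightarrow>
     (\<exists>\<epsilon>\<in>{1, -1}. \<exists>s. \<forall>i. \<Gamma>' i = \<Gamma> (\<epsilon> * i + s))"

end

theory Submission
  imports Defs
begin

text \<open>
  A row of the matrix with sum 2 is a multiset of two colours, and a colouring is perfect exactly
  when the two neighbours of every vertex carry the multiset of that vertex's row.  Hence the
  colours of two adjacent vertices determine the colour of the next vertex on either side: in the
  row of the vertex just reached, strike out one copy of the colour that one came from, and one
  colour is left.  Everything follows from this determinism.

  \<^item> Existence: walk in both directions from an edge with colours \<open>a\<close>, \<open>b\<close> such that
    \<open>M\<^sub>a\<^sub>b \<noteq> 0\<close>.  The step from \<open>b\<close> to \<open>c\<close> is followed by one that needs \<open>b\<close> to occur in the row of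
    \<open>c\<close>, and the symmetry of the zero pattern guarantees this.

  \<^item> Two perfect colourings that agree on one edge are equal (\<open>perfect_path_coloring_eqI\<close>), and
    shifts and reflections preserve perfectness.

  \<^item> Periodicity: finitely many colours give finitely many coloured edges, so some coloured edge
    recurs at two positions, and the shift between them fixes the colouring.

  \<^item> Uniqueness: the set of colours used is closed under passing to neighbours, so irreducibility
    makes every colour occur.  Hence a vertex of the second colouring has the same colour as some
    vertex of the first.  The neighbours of these two vertices carry the same two colours, in the
    same order or in the opposite one, so after a shift and possibly a reflection the colourings
    agree on an edge.
\<close>

section \<open>Perfect colourings as walks\<close>

definition row_is_pair :: "nat \<Rightarrow> nat mat \<Rightarrow> nat \<Rightarrow> nat \<Rightarrow> nat \<Rightarrow> bool" where
  "row_is_pair n M b a c \<longleftrightarrow> (\<forall>d<n. M $$ (b, d) = of_bool (a = d) + of_bool (c = d))"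

lemma row_is_pair_commute: "row_is_pair n M b a c \<longleftrightarrow> row_is_pair n M b c a"
  by (auto simp: row_is_pair_def add.commute)

lemma row_is_pair_cases:
  assumes "row_is_pair n M b a c" "row_is_pair n M b a' c'" "a < n" "c < n" "a' < n" "c' < n"
  shows "a' = a \<and> c' = c \<or> a' = c \<and> c' = a"
proof -
  have eq: "of_bool (a = d) + of_bool (c = d) = (of_bool (a' = d) + of_bool (c' = d) :: nat)"
    if "d < n" for d
    using assms(1,2) that by (metis row_is_pair_def)
  show ?thesis
    using eq[OF assms(3)] eq[OF assms(4)]
    by (cases "a = c"; cases "a' = a"; cases "a' = c"; cases "c' = a"; cases "c' = c") simp_all
qed

lemma row_is_pair_unique:
  assumes "row_is_pair n M b a c" "row_is_pair n M b a c'" "a < n" "c < n" "c' < n"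
  shows "c' = c"
  using row_is_pair_cases[OF assms(1,2,3,4,3,5)] by auto

lemma row_is_pair_nonzero:
  assumes "row_is_pair n M b a c" and "c < n"
  shows "M $$ (b, c) \<noteq> 0"
  using assms by (auto simp: row_is_pair_def)

text \<open>Subtracting one occurrence of \<open>a\<close> leaves a row of natural numbers with sum 1, that is, a
  single entry 1.\<close>

lemma row_is_pair_exists:
  fixes M :: "nat mat"
  assumes "(\<Sum>j<n. M $$ (b, j)) = 2" and "a < n" and "M $$ (b, a) \<noteq> 0"
  shows "\<exists>c<n. row_is_pair n M b a c"
proof -
  let ?r = "\<lambda>d. M $$ (b, d) - of_bool (a = d)"
  have split: "M $$ (b, d) = ?r d + of_bool (a = d)" for d
    using assms(3) by auto
  have "2 = (\<Sum>d<n. ?r d + of_bool (a = d))"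
    using assms(1) by (simp only: split[symmetric])
  also have "\<dots> = (\<Sum>d<n. ?r d) + (\<Sum>d<n. of_bool (a = d))"
    by (rule sum.distrib)
  also have "(\<Sum>d<n. of_bool (a = d)) = (1 :: nat)"
    using assms(2) by (simp add: of_bool_def)
  finally have "(\<Sum>d<n. ?r d) = 1"
    by simp
  then obtain c where c: "c < n" "?r c = 1" "\<And>d. d < n \<Longrightarrow> c \<noteq> d \<Longrightarrow> ?r d = 0"
    by (subst (asm) sum_eq_1_iff) auto
  have "M $$ (b, d) = of_bool (a = d) + of_bool (c = d)" if "d < n" for d
    using c(2) c(3)[OF that] assms(3) by (cases "c = d"; cases "a = d") auto
  then show ?thesis
    using c(1) by (auto simp: row_is_pair_def)
qed

lemma perfect_path_coloring_iff:
  "perfect_path_coloring n M \<Gamma> \<longleftrightarrow>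
     (\<forall>i. \<Gamma> i < n) \<and> (\<forall>i. row_is_pair n M (\<Gamma> i) (\<Gamma> (i - 1)) (\<Gamma> (i + 1)))"
proof -
  have "card {j \<in> {i - 1, i + 1}. \<Gamma> j = c} = of_bool (\<Gamma> (i - 1) = c) + of_bool (\<Gamma> (i + 1) = c)"
    for i c
  proof -
    have "{j \<in> {i - 1, i + 1}. \<Gamma> j = c} =
        (if \<Gamma> (i - 1) = c then {i - 1} else {}) \<union> (if \<Gamma> (i + 1) = c then {i + 1} else {})"
      by auto
    then show ?thesis
      by simp
  qed
  then show ?thesis
    by (simp only: perfect_path_coloring_def row_is_pair_def eq_commute[of "M $$ _"])
qed

lemma perfect_path_coloring_shift_reflect:
  assumes "perfect_path_coloring n M \<Gamma>" and "\<epsilon> \<in> {1, -1}"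
  shows "perfect_path_coloring n M (\<lambda>i. \<Gamma> (\<epsilon> * i + s))"
proof -
  have "row_is_pair n M (\<Gamma> (\<epsilon> * i + s)) (\<Gamma> (\<epsilon> * (i - 1) + s)) (\<Gamma> (\<epsilon> * (i + 1) + s))" for i
  proof (cases "\<epsilon> = 1")
    case True
    have "row_is_pair n M (\<Gamma> (i + s)) (\<Gamma> (i + s - 1)) (\<Gamma> (i + s + 1))"
      using assms(1) by (auto simp: perfect_path_coloring_iff)
    then show ?thesis
      using True by (simp add: algebra_simps)
  next
    case False
    then have "\<epsilon> = -1"
      using assms(2) by auto
    moreover have "row_is_pair n M (\<Gamma> (s - i)) (\<Gamma> (s - i + 1)) (\<Gamma> (s - i - 1))"
      using assms(1) by (auto simp: perfect_path_coloring_iff row_is_pair_commute)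
    ultimately show ?thesis
      by (simp add: algebra_simps)
  qed
  then show ?thesis
    using assms(1) by (auto simp: perfect_path_coloring_iff)
qed

section \<open>Determinism\<close>

lemma perfect_path_colorings_agree_forward:
  assumes "perfect_path_coloring n M \<Gamma>" "perfect_path_coloring n M \<Gamma>'"
    and "\<Gamma> 0 = \<Gamma>' 0" "\<Gamma> 1 = \<Gamma>' 1"
  shows "\<Gamma> (int k) = \<Gamma>' (int k) \<and> \<Gamma> (int k + 1) = \<Gamma>' (int k + 1)"
proof (induction k)
  case 0
  then show ?case using assms by simp
next
  case (Suc k)
  have "row_is_pair n M (\<Gamma> (int k + 1)) (\<Gamma> (int k)) (\<Gamma> (int k + 2))"
    using assms(1)[unfolded perfect_path_coloring_iff, THEN conjunct2, rule_format, of "int k + 1"]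
    by (simp add: algebra_simps)
  moreover have "row_is_pair n M (\<Gamma> (int k + 1)) (\<Gamma> (int k)) (\<Gamma>' (int k + 2))"
    using assms(2)[unfolded perfect_path_coloring_iff, THEN conjunct2, rule_format, of "int k + 1"]
      Suc.IH
    by (simp add: algebra_simps)
  ultimately have "\<Gamma>' (int k + 2) = \<Gamma> (int k + 2)"
    using assms(1,2) by (intro row_is_pair_unique) (auto simp: perfect_path_coloring_iff)
  then show ?case
    using Suc.IH by (simp add: algebra_simps)
qed

lemma perfect_path_coloring_eqI:
  assumes "perfect_path_coloring n M \<Gamma>" "perfect_path_coloring n M \<Gamma>'"
    and "\<Gamma> 0 = \<Gamma>' 0" "\<Gamma> 1 = \<Gamma>' 1"
  shows "\<Gamma> i = \<Gamma>' i"
proof (cases "i \<ge> 0")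
  case True
  then show ?thesis
    using perfect_path_colorings_agree_forward[OF assms, of "nat i"] by simp
next
  case False
  \<comment> \<open>The reflection \<open>i \<mapsto> 1 - i\<close> swaps the ends of the edge on which the colourings agree and
    turns negative positions into positive ones.\<close>
  have "perfect_path_coloring n M (\<lambda>i. \<Delta> (-1 * i + 1))" if "perfect_path_coloring n M \<Delta>" for \<Delta>
    using that by (rule perfect_path_coloring_shift_reflect) simp
  from perfect_path_colorings_agree_forward[OF this[OF assms(1)] this[OF assms(2)], of "nat (1 - i)"]
  show ?thesis
    using assms(3,4) False by simp
qed

lemma perfect_path_coloring_periodic:
  assumes "perfect_path_coloring n M \<Gamma>"
  shows "periodic_coloring \<Gamma>"
proof -
  let ?e = "\<lambda>k::nat. (\<Gamma> (int k), \<Gamma> (int k + 1))"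
  have "range ?e \<subseteq> {..<n} \<times> {..<n}"
    using assms by (auto simp: perfect_path_coloring_def)
  then have "finite (range ?e)"
    by (rule finite_subset) simp
  then have "\<not> inj ?e"
    using finite_imageD infinite_UNIV_nat by blast
  then obtain k k' where "k < k'" "?e k = ?e k'"
    unfolding inj_def by (metis linorder_neqE_nat)
  have shift: "perfect_path_coloring n M (\<lambda>i. \<Gamma> (1 * i + int m))" for m
    using assms by (rule perfect_path_coloring_shift_reflect) simp
  have agree: "\<Gamma> (1 * i + int k) = \<Gamma> (1 * i + int k')" for i
    by (rule perfect_path_coloring_eqI[OF shift shift]) (use \<open>?e k = ?e k'\<close> in \<open>auto simp: add.commute\<close>)
  have "\<Gamma> i = \<Gamma> (i + int (k' - k))" for i
    using agree[of "i - int k"] \<open>k < k'\<close> by (simp add: algebra_simps)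
  then show ?thesis
    using \<open>k < k'\<close> unfolding periodic_coloring_def by (metis less_eq_Suc_le One_nat_def zero_less_diff)
qed

section \<open>Existence\<close>

text \<open>The next colour depends on the last two, so the recursion runs over edges \<open>(a, b)\<close> with
  \<open>M\<^sub>a\<^sub>b \<noteq> 0\<close> rather than over single colours.\<close>

lemma one_sided_walk_exists:
  fixes M :: "nat mat"
  assumes rows: "\<And>i. i < n \<Longrightarrow> (\<Sum>j<n. M $$ (i, j)) = 2"
    and zeros: "\<And>i j. i < n \<Longrightarrow> j < n \<Longrightarrow> M $$ (i, j) = 0 \<longleftrightarrow> M $$ (j, i) = 0"
    and ab: "a < n" "b < n" "M $$ (a, b) \<noteq> 0"
  shows "\<exists>x :: nat \<Rightarrow> nat. x 0 = a \<and> x 1 = b \<and> (\<forall>k. x k < n) \<and>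
    (\<forall>k. row_is_pair n M (x (Suc k)) (x k) (x (Suc (Suc k))))"
proof -
  let ?ok = "\<lambda>(a, b). a < n \<and> b < n \<and> M $$ (a, b) \<noteq> 0"
  let ?step = "\<lambda>(a, b) (b', c). b' = b \<and> row_is_pair n M b a c"
  have next_edge: "\<exists>q. ?ok q \<and> ?step p q" if "?ok p" for p
  proof -
    obtain a b where p_eq: "p = (a, b)"
      by (cases p)
    with that have p: "a < n" "b < n" "M $$ (a, b) \<noteq> 0"
      by simp_all
    have ba: "M $$ (b, a) \<noteq> 0"
      using p(3) unfolding zeros[OF p(1,2)] .
    obtain c where c: "c < n" "row_is_pair n M b a c"
      using row_is_pair_exists[OF rows[OF p(2)] p(1) ba] by blast
    then have "?ok (b, c) \<and> ?step p (b, c)"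
      using p_eq p(2) row_is_pair_nonzero[OF c(2,1)] by simp
    then show ?thesis
      by (rule exI)
  qed
  have "\<exists>e. \<forall>k. (?ok (e k) \<and> (k = 0 \<longrightarrow> e k = (a, b))) \<and> ?step (e k) (e (Suc k))"
  proof (rule dependent_nat_choice)
    show "\<exists>p. ?ok p \<and> ((0::nat) = 0 \<longrightarrow> p = (a, b))"
      using ab by (intro exI[of _ "(a, b)"]) simp
  next
    fix p and k :: nat
    assume "?ok p \<and> (k = 0 \<longrightarrow> p = (a, b))"
    then have "?ok p"
      by (rule conjunct1)
    from next_edge[OF this] show "\<exists>q. (?ok q \<and> (Suc k = 0 \<longrightarrow> q = (a, b))) \<and> ?step p q"
      by simp
  qed
  then obtain e where e_all:
    "\<forall>k. (?ok (e k) \<and> (k = 0 \<longrightarrow> e k = (a, b))) \<and> ?step (e k) (e (Suc k))"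
    by (rule exE)
  note ok = e_all[THEN spec, THEN conjunct1, THEN conjunct1]
  note step = e_all[THEN spec, THEN conjunct2]
  have e0: "e 0 = (a, b)"
    using e_all[THEN spec, THEN conjunct1, THEN conjunct2, of 0] by simp
  have fst_Suc: "fst (e (Suc k)) = snd (e k)" for k
    using step[of k] by (simp add: case_prod_beta)
  have "row_is_pair n M (fst (e (Suc k))) (fst (e k)) (fst (e (Suc (Suc k))))" for k
    using step[of k] by (simp add: case_prod_beta fst_Suc)
  moreover have "fst (e k) < n" for k
    using ok[of k] by (simp add: case_prod_beta)
  ultimately show ?thesis
    using e0 fst_Suc[of 0] by (intro exI[of _ "\<lambda>k. fst (e k)"]) simp
qed

lemma perfect_path_coloring_exists:
  fixes M :: "nat mat"
  assumes "n \<ge> 1"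
    and rows: "\<And>i. i < n \<Longrightarrow> (\<Sum>j<n. M $$ (i, j)) = 2"
    and zeros: "\<And>i j. i < n \<Longrightarrow> j < n \<Longrightarrow> M $$ (i, j) = 0 \<longleftrightarrow> M $$ (j, i) = 0"
  shows "\<exists>\<Gamma>. perfect_path_coloring n M \<Gamma>"
proof -
  have "(\<Sum>j<n. M $$ (0, j)) \<noteq> 0"
    using rows[of 0] assms(1) by simp
  then obtain b where b: "b < n" "M $$ (0, b) \<noteq> 0"
    by (meson lessThan_iff sum.neutral)
  obtain x where x: "x 0 = 0" "x 1 = b" "\<And>k. x k < n"
    "\<And>k. row_is_pair n M (x (Suc k)) (x k) (x (Suc (Suc k)))"
    using one_sided_walk_exists[OF rows zeros _ b] assms(1) by fastforce
  obtain y where y: "y 0 = b" "y 1 = 0" "\<And>k. y k < n"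
    "\<And>k. row_is_pair n M (y (Suc k)) (y k) (y (Suc (Suc k)))"
    using one_sided_walk_exists[OF rows zeros b(1), of 0] b zeros[of 0 b] assms(1) by fastforce
  \<comment> \<open>The backward walk starts with the reversed edge, so position \<open>i\<close> is its step \<open>1 - i\<close>, and both
    walks cover positions 0 and 1.\<close>
  define \<Gamma> where "\<Gamma> i = (if i \<ge> 0 then x (nat i) else y (nat (1 - i)))" for i :: int
  have \<Gamma>y: "\<Gamma> i = y (nat (1 - i))" if "i \<le> 1" for i
  proof -
    have "i = 0 \<or> i = 1 \<or> i < 0"
      using that by linarith
    then show ?thesis
      using x(1,2) y(1,2) by (elim disjE) (simp_all add: \<Gamma>_def)
  qed
  have "row_is_pair n M (\<Gamma> i) (\<Gamma> (i - 1)) (\<Gamma> (i + 1))" for i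
  proof (cases "i \<ge> 1")
    case True
    then obtain k where "i = int k + 1"
      by (metis add.commute zle_iff_zadd)
    then have "\<Gamma> i = x (Suc k)" "\<Gamma> (i - 1) = x k" "\<Gamma> (i + 1) = x (Suc (Suc k))"
      by (simp_all add: \<Gamma>_def nat_add_distrib)
    then show ?thesis
      using x(4) by simp
  next
    case False
    define k where "k = nat (- i)"
    have "nat (1 - i) = Suc k" "nat (1 - (i + 1)) = k" "nat (1 - (i - 1)) = Suc (Suc k)"
      using False by (auto simp: k_def)
    then have "\<Gamma> i = y (Suc k)" "\<Gamma> (i + 1) = y k" "\<Gamma> (i - 1) = y (Suc (Suc k))"
      using False by (simp_all add: \<Gamma>y)
    then show ?thesis
      using y(4)[of k] by (simp add: row_is_pair_commute)
  qed
  moreover have "\<Gamma> i < n" for i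
    using x(3) y(3) by (simp add: \<Gamma>_def)
  ultimately show ?thesis
    by (auto simp: perfect_path_coloring_iff)
qed

section \<open>Irreducibility and uniqueness\<close>

lemma permutes_initial_segment_onto:
  fixes S :: "nat set"
  assumes "S \<subseteq> {..<n}"
  obtains p where "p permutes {..<n}" and "p ` {..<card S} = S"
proof -
  have fin: "finite S"
    using assms finite_subset by blast
  have le: "card S \<le> n"
    using card_mono[OF _ assms] by simp
  obtain f where f: "bij_betw f {..<card S} S"
    using fin by (metis card_lessThan finite_lessThan finite_same_card_bij)
  have "card {card S..<n} = card ({..<n} - S)"
    using assms fin by (simp add: card_Diff_subset)
  then obtain g where g: "bij_betw g {card S..<n} ({..<n} - S)"
    by (meson finite_Diff finite_atLeastLessThan finite_lessThan finite_same_card_bij)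
  define p where "p i = (if i < card S then f i else if i < n then g i else i)" for i
  have pf: "bij_betw p {..<card S} S"
    using f by (rule bij_betw_cong[THEN iffD1, rotated]) (simp add: p_def)
  have pg: "bij_betw p {card S..<n} ({..<n} - S)"
    using g by (rule bij_betw_cong[THEN iffD1, rotated]) (simp add: p_def)
  have "bij_betw p ({..<card S} \<union> {card S..<n}) (S \<union> ({..<n} - S))"
    using pf pg by (rule bij_betw_combine) auto
  moreover have "{..<card S} \<union> {card S..<n} = {..<n}" "S \<union> ({..<n} - S) = {..<n}"
    using le assms by auto
  ultimately have "bij_betw p {..<n} {..<n}"
    by simp
  then have "p permutes {..<n}"
    by (rule bij_imp_permutes) (use le in \<open>auto simp: p_def\<close>)
  then show ?thesis
    using that pf by (auto simp: bij_betw_def)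
qed

text \<open>Irreducibility as connectedness: listing the elements of a proper closed set first would put
  a zero block below the diagonal.\<close>

lemma irreducible_mat_closed_set_eq:
  fixes A :: "'a :: zero mat"
  assumes irr: "irreducible_mat n A"
    and S: "S \<subseteq> {..<n}" "S \<noteq> {}"
    and closed: "\<And>i j. i < n \<Longrightarrow> j \<in> S \<Longrightarrow> A $$ (i, j) \<noteq> 0 \<Longrightarrow> i \<in> S"
  shows "S = {..<n}"
proof (rule ccontr)
  assume "S \<noteq> {..<n}"
  then have "S \<subset> {..<n}"
    using S(1) by blast
  then have less: "card S < n"
    using psubset_card_mono[of "{..<n}" S] by simp
  have pos: "0 < card S"
    using S finite_subset[OF S(1)] by (simp add: card_gt_0_iff)
  obtain p where p: "p permutes {..<n}" "p ` {..<card S} = S"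
    using permutes_initial_segment_onto[OF S(1)] .
  have below: "A $$ (p i, p j) = 0" if "card S \<le> i" "i < n" "j < card S" for i j
  proof -
    have "p j \<in> S"
      using p(2) that(3) by blast
    moreover have "p i \<notin> S"
    proof
      assume "p i \<in> S"
      then obtain i' where "i' < card S" "p i = p i'"
        using p(2) by auto
      then show False
        using permutes_inj[OF p(1)] that(1) by (metis injD not_le)
    qed
    moreover have "p i < n"
      using permutes_in_image[OF p(1)] that(2) by simp
    ultimately show ?thesis
      using closed by blast
  qed
  let ?k = "card S"
  let ?B = "mat ?k ?k (\<lambda>(i, j). A $$ (p i, p j))"
  let ?C = "mat ?k (n - ?k) (\<lambda>(i, j). A $$ (p i, p (j + ?k)))"
  let ?D = "mat (n - ?k) (n - ?k) (\<lambda>(i, j). A $$ (p (i + ?k), p (j + ?k)))"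
  have "mat n n (\<lambda>(i, j). A $$ (p i, p j)) = four_block_mat ?B ?C (0\<^sub>m (n - ?k) ?k) ?D"
    by (rule eq_matI) (use less below in \<open>auto simp: not_less\<close>)
  then have "reducible_mat n A"
    unfolding reducible_mat_def using p(1) pos less
    by (intro exI[of _ p] exI[of _ ?k] exI[of _ ?B] exI[of _ ?C] exI[of _ ?D]) simp
  then show False
    using irr by (simp add: irreducible_mat_def)
qed

lemma perfect_path_coloring_range:
  assumes perf: "perfect_path_coloring n M \<Gamma>"
    and irr: "irreducible_mat n M"
    and zeros: "\<And>i j. i < n \<Longrightarrow> j < n \<Longrightarrow> M $$ (i, j) = 0 \<longleftrightarrow> M $$ (j, i) = 0"
  shows "range \<Gamma> = {..<n}"
proof (rule irreducible_mat_closed_set_eq[OF irr])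
  show sub: "range \<Gamma> \<subseteq> {..<n}"
    using perf by (auto simp: perfect_path_coloring_def)
  fix c d
  assume c: "c < n" and "d \<in> range \<Gamma>" and nz: "M $$ (c, d) \<noteq> 0"
  then obtain i where i: "d = \<Gamma> i"
    by blast
  have "M $$ (\<Gamma> i, c) \<noteq> 0"
    using zeros[OF c, of d] nz sub i by auto
  moreover have "row_is_pair n M (\<Gamma> i) (\<Gamma> (i - 1)) (\<Gamma> (i + 1))"
    using perf by (simp add: perfect_path_coloring_iff)
  ultimately have "c = \<Gamma> (i - 1) \<or> c = \<Gamma> (i + 1)"
    using c by (auto simp: row_is_pair_def of_bool_def split: if_splits)
  then show "c \<in> range \<Gamma>"
    by blast
qed simp

lemma perfect_path_coloring_unique:
  assumes perf: "perfect_path_coloring n M \<Gamma>" "perfect_path_coloring n M \<Gamma>'"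
    and irr: "irreducible_mat n M"
    and zeros: "\<And>i j. i < n \<Longrightarrow> j < n \<Longrightarrow> M $$ (i, j) = 0 \<longleftrightarrow> M $$ (j, i) = 0"
  shows "shift_reflection_equiv \<Gamma> \<Gamma>'"
proof -
  have "\<Gamma>' 0 \<in> range \<Gamma>"
    using perfect_path_coloring_range[OF perf(1) irr zeros] perf(2)
    by (auto simp: perfect_path_coloring_def)
  then obtain k where k: "\<Gamma> k = \<Gamma>' 0"
    by auto
  have "row_is_pair n M (\<Gamma> k) (\<Gamma> (k - 1)) (\<Gamma> (k + 1))"
    using perf(1) by (simp add: perfect_path_coloring_iff)
  moreover have "row_is_pair n M (\<Gamma> k) (\<Gamma>' (0 - 1)) (\<Gamma>' (0 + 1))"
    using perf(2) unfolding k perfect_path_coloring_iff by blast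
  ultimately have "\<Gamma>' (0 + 1) = \<Gamma> (k + 1) \<or> \<Gamma>' (0 + 1) = \<Gamma> (k - 1)"
    using row_is_pair_cases perf unfolding perfect_path_coloring_iff by metis
  then obtain \<epsilon> where \<epsilon>: "\<epsilon> \<in> {1, -1}" "\<Gamma>' 1 = \<Gamma> (\<epsilon> * 1 + k)"
  proof
    assume "\<Gamma>' (0 + 1) = \<Gamma> (k + 1)"
    then show thesis
      using that[of 1] by (simp add: add.commute)
  next
    assume "\<Gamma>' (0 + 1) = \<Gamma> (k - 1)"
    then show thesis
      using that[of "-1"] by simp
  qed
  have "\<Gamma>' i = \<Gamma> (\<epsilon> * i + k)" for i
    by (rule perfect_path_coloring_eqI[OF perf(2) perfect_path_coloring_shift_reflect[OF perf(1) \<epsilon>(1)]])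
      (use k \<epsilon>(2) in simp_all)
  then show ?thesis
    using \<epsilon>(1) unfolding shift_reflection_equiv_def by blast
qed

theorem lemma4p1:
  fixes n :: nat and M :: "nat mat"
  assumes "n \<ge> 1"
    and "M \<in> carrier_mat n n"
    and "irreducible_mat n M"
    and "\<And>i. i < n \<Longrightarrow> (\<Sum>j<n. M $$ (i, j)) = 2"
    and "\<And>j. j < n \<Longrightarrow> (\<Sum>i<n. M $$ (i, j)) = 2"
    and "\<And>i j. i < n \<Longrightarrow> j < n \<Longrightarrow> M $$ (i, j) = 0 \<longleftrightarrow> M $$ (j, i) = 0"
  shows "(\<exists>\<Gamma>. perfect_path_coloring n M \<Gamma>) \<and>
    (\<forall>\<Gamma> \<Gamma>'. perfect_path_coloring n M \<Gamma> \<longrightarrow> perfect_path_coloring n M \<Gamma>' \<longrightarrow>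
       shift_reflection_equiv \<Gamma> \<Gamma>') \<and>
    (\<forall>\<Gamma>. perfect_path_coloring n M \<Gamma> \<longrightarrow> periodic_coloring \<Gamma>)"
  using perfect_path_coloring_exists[OF assms(1,4,6)]
    perfect_path_coloring_unique[OF _ _ assms(3,6)] perfect_path_coloring_periodic
  by blast

end
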